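(* Let $\mathbb{X}$ be a traced extensive restriction category with parametrized iteration operator $\mathsf{Iter}$ and induced trace operator $\mathsf{Tr}$. For $\perp_d$-disjoint maps $f:X\to X$ and $g:X\to A$ define $$ f\circledast g:=\mathsf{Iter}^X_A\big(\begin{bmatrix} f&g\end{bmatrix}\big)=\mathsf{Tr}^X_{X,A}\big(\nabla_X\begin{bmatrix} f&g\end{bmatrix}\big). $$ Then $\circledast$ is a Kleene wand for $\perp_d$, so $(\mathbb{X},\circledast)$ is a $\perp_d$-itegory. Moreover, if $\mathsf{Iter}$ is uniform, then $\circledast$ is uniform.
   Context: Composition is diagrammatic: $fg$ means first $f$, then $g$. A restriction category is a category with an operator sending each $f:A\to B$ to $\overline{f}:A\to A$ such that $\overline{f}f=f$; $\overline{f}\,\overline{g}=\overline{g}\,\overline{f}$ and $\overline{\overline{g}f}=\overline{g}\,\overline{f}$ for $f:A\to B$, $g:A\to C$; and $f\overline{g}=\overline{fg}f$ for $f:A\to B$, $g:B\to C$. For parallel $f,g$: $f\le g$ iff $\overline{f}g=f$. A map $f:A\to B$ is total if $\overline{f}=1_A$. Restriction zeroes: maps $0:A\to B$ with $f0=0=0f$ and $\overline{0}=0$. A coCartesian restriction category is a restriction category with finite coproducts whose injections $\iota_j$ are total. With restriction zeroes, the quasi-projection $\iota_j^\circ:A_1+\dots+A_n\to A_j$ is the unique map with $\iota_j\iota_j^\circ=1_{A_j}$ and $\iota_i\iota_j^\circ=0$ for $i\ne j$. $\nabla:A+\dots+A\to A$ is the codiagonal; copairing is written as a column. An extensive restriction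 category is a coCartesian restriction category with restriction zeroes such that for every $f:A\to B_1+\dots+B_n$ there is a (necessarily unique) map $\langle f\rangle:A\to A+\dots+A$ ($n$ copies) with $\overline{f}=\langle f\rangle\nabla$ and $\langle f\rangle(f+\dots+f)=f(\iota_1+\dots+\iota_n)$. A map $d:A\to A+\dots+A$ is a decision if $\langle d\rangle=d$. For $f:A\to B$, $g:A\to C$, $f\perp_d g$ iff there is a (necessarily unique) decision $\langle f\vert g\rangle:A\to A+A$ with $\langle f\vert g\rangle\iota_1^\circ=\overline{f}$, $\langle f\vert g\rangle\iota_2^\circ=\overline{g}$. This is an interference relation with all binary joins: for parallel $f\perp_d g:A\to B$, $f\sqcup g:=\langle f\vert g\rangle(f+g)\nabla$ is their least upper bound for $\le$, and it is preserved by precomposition. For $f\perp_d g$, $\begin{bmatrix} f&g\end{bmatrix}:=\langle f\vert g\rangle(f+g):A\to B+C$; every map $h:A\to B+C$ is uniquely of this form, with $f=h\iota_1^\circ$, $g=h\iota_2^\circ$. A Kleene wand $\circledast$ with respect to $\perp=\perp_d$ assigns to each $f:X\to X$, $g:X\to A$ with $f\perp g$ a map $f\circledast g:X\to A$ such that: (1) if $f \perp g$, then $g\sqcup f(f\circledast g)=f\circledast g$; (2) $(f\circledast g)h=f\circledast gh$ for $f\perp g$, $h:A\to B$; (3) for $f:X\to Y$, $g:X\to A$, $k:Y\to X$ with $f\perp g$: $kf\circledast kg=k(fk\circledast g)$; (4) for $f,f':X\to X$, $g:X\to A$ with $f\perp f'$ and $f\sqcup f'\perp g$: $(f\circledast f')\perp(f\circledast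 g)$ and $(f\sqcup f')\circledast g=(f\circledast f')\circledast(f\circledast g)$. A $\perp_d$-itegory here means the category with such a wand. The wand is uniform if for $f:X\to X$, $g:X\to A$, $f':Y\to Y$, $g':Y\to A$, $h:X\to Y$ with $f\perp g$, $f'\perp g'$, $hg'=g$, $hf'=fh$ one has $h(f'\circledast g')=f\circledast g$. A parametrized iteration operator on a category with finite coproducts is a family of operators $\mathsf{Iter}^X_A$ sending $f:X\to X+A$ to $\mathsf{Iter}^X_A(f):X\to A$ such that: [Parametrized Iteration] $f\left[\begin{smallmatrix}\mathsf{Iter}^X_A(f)\\ 1_A\end{smallmatrix}\right]=\mathsf{Iter}^X_A(f)$; [Naturality] $\mathsf{Iter}^X_A(f(1_X+h))=\mathsf{Iter}^X_{A'}(f)h$ for $f:X\to X+A'$, $h:A'\to A$; [Dinaturality] $\mathsf{Iter}^X_A(kf)=k\,\mathsf{Iter}^{X'}_A(f(k+1_A))$ for $f:X'\to X+A$, $k:X\to X'$; [Diagonal] $\mathsf{Iter}^X_A(\mathsf{Iter}^X_{X+A}(f))=\mathsf{Iter}^X_A(f(\nabla_X+1_A))$ for $f:X\to X+X+A$. It is uniform if $f(h+1_A)=hf'$ (with $f:X\to X+A$, $f':Y\to Y+A$, $h:X\to Y$) implies $\mathsf{Iter}^X_A(f)=h\,\mathsf{Iter}^Y_A(f')$. The induced trace operator is $\mathsf{Tr}^X_{A,B}(f)=\iota_2f\left[\begin{smallmatrix}\mathsf{Iter}^X_B(\iota_1f)\\1_B\end{smallmatrix}\right]$ for $f:X+A\to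 X+B$. A traced extensive restriction category is an extensive restriction category equipped with a parametrized iteration operator (equivalently, with a trace operator for the coproduct). *)

theory Defs
  imports Main
begin

text \<open>
  Composition is diagrammatic: \<open>f \<cdot> g\<close> is first \<open>f\<close>, then \<open>g\<close>. Finite coproducts are chosen,
  one for every list of objects, and are indexed from 0, so \<open>\<iota>\<^sub>1\<close> on \<open>A + B\<close> is
  \<open>inj\<^sub>c [A, B] 0\<close>. The coproduct operation need not be injective on objects, so operations on
  maps into or out of a coproduct take the summands as arguments.
\<close>

section \<open>Restriction categories\<close>

record ('o, 'm) cat =
  Ob :: "'o set"
  Mor :: "'m set"
  Dom :: "'m \<Rightarrow> 'o"
  Cod :: "'m \<Rightarrow> 'o"
  Comp :: "'m \<Rightarrow> 'm \<Rightarrow> 'm" (infixl "\<cdot>\<index>" 70)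
  Idn :: "'o \<Rightarrow> 'm" ("\<one>\<index>")

definition hom :: "('o, 'm, 'x) cat_scheme \<Rightarrow> 'o \<Rightarrow> 'o \<Rightarrow> 'm set" where
  "hom C A B = {f \<in> Mor C. Dom C f = A \<and> Cod C f = B}"

locale category =
  fixes C (structure)
  assumes dom_Ob: "f \<in> Mor C \<Longrightarrow> Dom C f \<in> Ob C"
    and cod_Ob: "f \<in> Mor C \<Longrightarrow> Cod C f \<in> Ob C"
    and id_hom: "A \<in> Ob C \<Longrightarrow> \<one> A \<in> hom C A A"
    and comp_hom: "\<lbrakk>f \<in> hom C A B; g \<in> hom C B D\<rbrakk> \<Longrightarrow> f \<cdot> g \<in> hom C A D"
    and id_left: "f \<in> hom C A B \<Longrightarrow> \<one> A \<cdot> f = f"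
    and id_right: "f \<in> hom C A B \<Longrightarrow> f \<cdot> \<one> B = f"
    and comp_assoc:
      "\<lbrakk>f \<in> hom C A B; g \<in> hom C B D; h \<in> hom C D E\<rbrakk> \<Longrightarrow> (f \<cdot> g) \<cdot> h = f \<cdot> (g \<cdot> h)"

record ('o, 'm) rcat = "('o, 'm) cat" +
  Rst :: "'m \<Rightarrow> 'm" ("\<rho>\<index>")

locale restriction_category = category C for C (structure) +
  assumes rst_hom: "f \<in> hom C A B \<Longrightarrow> \<rho> f \<in> hom C A A"
    and rst_comp: "f \<in> hom C A B \<Longrightarrow> \<rho> f \<cdot> f = f"
    and rst_commute: "\<lbrakk>f \<in> hom C A B; g \<in> hom C A D\<rbrakk> \<Longrightarrow> \<rho> f \<cdot> \<rho> g = \<rho> g \<cdot> \<rho> f"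
    and rst_rst_comp: "\<lbrakk>f \<in> hom C A B; g \<in> hom C A D\<rbrakk> \<Longrightarrow> \<rho> (\<rho> g \<cdot> f) = \<rho> g \<cdot> \<rho> f"
    and comp_rst: "\<lbrakk>f \<in> hom C A B; g \<in> hom C B D\<rbrakk> \<Longrightarrow> f \<cdot> \<rho> g = \<rho> (f \<cdot> g) \<cdot> f"

definition total_map :: "('o, 'm, 'x) rcat_scheme \<Rightarrow> 'm \<Rightarrow> bool" where
  "total_map C f \<longleftrightarrow> f \<in> Mor C \<and> \<rho> f = \<one> (Dom C f)"
  for C (structure)

section \<open>Finite coproducts and restriction zeroes\<close>

record ('o, 'm) ecat = "('o, 'm) rcat" +
  Coprod :: "'o list \<Rightarrow> 'o" ("\<Oplus>\<index>")
  Inj :: "'o list \<Rightarrow> nat \<Rightarrow> 'm" ("inj\<^sub>c\<index>")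
  Zero :: "'o \<Rightarrow> 'o \<Rightarrow> 'm" ("\<zero>\<index>")

locale cocartesian_restriction_category = restriction_category C for C (structure) +
  assumes coprod_Ob: "set As \<subseteq> Ob C \<Longrightarrow> \<Oplus> As \<in> Ob C"
    and inj_hom: "\<lbrakk>set As \<subseteq> Ob C; i < length As\<rbrakk> \<Longrightarrow> inj\<^sub>c As i \<in> hom C (As ! i) (\<Oplus> As)"
    and inj_total: "\<lbrakk>set As \<subseteq> Ob C; i < length As\<rbrakk> \<Longrightarrow> total_map C (inj\<^sub>c As i)"
    and coprod_universal:
      "\<lbrakk>set As \<subseteq> Ob C; B \<in> Ob C; length fs = length As;
        \<And>i. i < length As \<Longrightarrow> fs ! i \<in> hom C (As ! i) B\<rbrakk>
       \<Longrightarrow> \<exists>!h. h \<in> hom C (\<Oplus> As) B \<and> (\<forall>i < length As. inj\<^sub>c As i \<cdot> h = fs ! i)"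

locale restriction_zeroes =
  fixes C (structure)
  assumes zero_hom: "\<lbrakk>A \<in> Ob C; B \<in> Ob C\<rbrakk> \<Longrightarrow> \<zero> A B \<in> hom C A B"
    and comp_zero: "\<lbrakk>f \<in> hom C A B; D \<in> Ob C\<rbrakk> \<Longrightarrow> f \<cdot> \<zero> B D = \<zero> A D"
    and zero_comp: "\<lbrakk>A \<in> Ob C; f \<in> hom C B D\<rbrakk> \<Longrightarrow> \<zero> A B \<cdot> f = \<zero> A D"
    and rst_zero: "\<lbrakk>A \<in> Ob C; B \<in> Ob C\<rbrakk> \<Longrightarrow> \<rho> (\<zero> A B) = \<zero> A A"

text \<open>The copairing (column) of the maps \<open>fs\<close> with common codomain \<open>B\<close>.\<close>

definition cotuple :: "('o, 'm, 'x) ecat_scheme \<Rightarrow> 'o \<Rightarrow> 'm list \<Rightarrow> 'm" where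
  "cotuple C B fs =
    (THE h. h \<in> hom C (\<Oplus> (map (Dom C) fs)) B \<and>
            (\<forall>i < length fs. inj\<^sub>c (map (Dom C) fs) i \<cdot> h = fs ! i))"
  for C (structure)

definition map_sum :: "('o, 'm, 'x) ecat_scheme \<Rightarrow> 'm list \<Rightarrow> 'm" where
  "map_sum C fs =
    cotuple C (\<Oplus> (map (Cod C) fs))
      (map (\<lambda>i. fs ! i \<cdot> inj\<^sub>c (map (Cod C) fs) i) [0..<length fs])"
  for C (structure)

definition codiag :: "('o, 'm, 'x) ecat_scheme \<Rightarrow> nat \<Rightarrow> 'o \<Rightarrow> 'm" where
  "codiag C n A = cotuple C A (replicate n (\<one> A))"
  for C (structure)

definition quasi_proj :: "('o, 'm, 'x) ecat_scheme \<Rightarrow> 'o list \<Rightarrow> nat \<Rightarrow> 'm" where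
  "quasi_proj C As j =
    (THE q. q \<in> hom C (\<Oplus> As) (As ! j) \<and> inj\<^sub>c As j \<cdot> q = \<one> (As ! j) \<and>
            (\<forall>i < length As. i \<noteq> j \<longrightarrow> inj\<^sub>c As i \<cdot> q = \<zero> (As ! i) (As ! j)))"
  for C (structure)

section \<open>Extensive restriction categories\<close>

text \<open>\<open>e\<close> satisfies the two equations characterizing \<open>\<langle>f\<rangle>\<close>, for \<open>f : A \<rightarrow> B\<^sub>1 + \<dots> + B\<^sub>n\<close>.\<close>

definition decides :: "('o, 'm, 'x) ecat_scheme \<Rightarrow> 'o list \<Rightarrow> 'm \<Rightarrow> 'm \<Rightarrow> bool" where
  "decides C Bs f e \<longleftrightarrow>
    e \<in> hom C (Dom C f) (\<Oplus> (replicate (length Bs) (Dom C f))) \<and>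
    \<rho> f = e \<cdot> codiag C (length Bs) (Dom C f) \<and>
    e \<cdot> map_sum C (replicate (length Bs) f) = f \<cdot> map_sum C (map (inj\<^sub>c Bs) [0..<length Bs])"
  for C (structure)

locale extensive_restriction_category =
  cocartesian_restriction_category C + restriction_zeroes C for C (structure) +
  assumes decision_exists:
    "\<lbrakk>set Bs \<subseteq> Ob C; f \<in> hom C A (\<Oplus> Bs)\<rbrakk> \<Longrightarrow> \<exists>e. decides C Bs f e"

definition decision_of :: "('o, 'm, 'x) ecat_scheme \<Rightarrow> 'o list \<Rightarrow> 'm \<Rightarrow> 'm" where
  "decision_of C Bs f = (THE e. decides C Bs f e)"

definition is_decision :: "('o, 'm, 'x) ecat_scheme \<Rightarrow> nat \<Rightarrow> 'o \<Rightarrow> 'm \<Rightarrow> bool" where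
  "is_decision C n A d \<longleftrightarrow>
    d \<in> hom C A (\<Oplus> (replicate n A)) \<and> decision_of C (replicate n A) d = d"
  for C (structure)

definition separates :: "('o, 'm, 'x) ecat_scheme \<Rightarrow> 'm \<Rightarrow> 'm \<Rightarrow> 'm \<Rightarrow> bool" where
  "separates C f g d \<longleftrightarrow>
    is_decision C 2 (Dom C f) d \<and>
    d \<cdot> quasi_proj C [Dom C f, Dom C f] 0 = \<rho> f \<and>
    d \<cdot> quasi_proj C [Dom C f, Dom C f] 1 = \<rho> g"
  for C (structure)

definition dperp :: "('o, 'm, 'x) ecat_scheme \<Rightarrow> 'm \<Rightarrow> 'm \<Rightarrow> bool" (infix "\<bottom>\<index>" 50) where
  "f \<bottom> g \<longleftrightarrow> f \<in> Mor C \<and> g \<in> Mor C \<and> Dom C f = Dom C g \<and> (\<exists>d. separates C f g d)"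
  for C (structure)

text \<open>\<open>\<langle>f | g\<rangle>\<close>, the row matrix \<open>[f g]\<close> and the join \<open>f \<squnion> g\<close>; only meaningful when \<open>f \<bottom> g\<close>.\<close>

definition separator :: "('o, 'm, 'x) ecat_scheme \<Rightarrow> 'm \<Rightarrow> 'm \<Rightarrow> 'm" where
  "separator C f g = (THE d. separates C f g d)"

definition row :: "('o, 'm, 'x) ecat_scheme \<Rightarrow> 'm \<Rightarrow> 'm \<Rightarrow> 'm" where
  "row C f g = separator C f g \<cdot> map_sum C [f, g]"
  for C (structure)

definition join :: "('o, 'm, 'x) ecat_scheme \<Rightarrow> 'm \<Rightarrow> 'm \<Rightarrow> 'm" (infixl "\<squnion>\<index>" 65) where
  "f \<squnion> g = separator C f g \<cdot> map_sum C [f, g] \<cdot> codiag C 2 (Cod C f)"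
  for C (structure)

section \<open>Kleene wands\<close>

text \<open>
  A wand is only meaningful on disjoint pairs, so its values on other pairs are left unconstrained.
  Each axiom asserts, besides the equation, that every wand and join occurring in it is applied
  to a disjoint pair.
\<close>

locale kleene_wand =
  fixes C (structure) and W :: "'m \<Rightarrow> 'm \<Rightarrow> 'm" (infix "\<circledast>" 68)
  assumes wand_hom: "\<lbrakk>f \<in> hom C X X; g \<in> hom C X A; f \<bottom> g\<rbrakk> \<Longrightarrow> f \<circledast> g \<in> hom C X A"
    and wand_unfold:
      "\<lbrakk>f \<in> hom C X X; g \<in> hom C X A; f \<bottom> g\<rbrakk>
       \<Longrightarrow> g \<bottom> (f \<cdot> (f \<circledast> g)) \<and> g \<squnion> (f \<cdot> (f \<circledast> g)) = f \<circledast> g"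
    and wand_natural:
      "\<lbrakk>f \<in> hom C X X; g \<in> hom C X A; h \<in> hom C A B; f \<bottom> g\<rbrakk>
       \<Longrightarrow> f \<bottom> (g \<cdot> h) \<and> (f \<circledast> g) \<cdot> h = f \<circledast> (g \<cdot> h)"
    and wand_dinatural:
      "\<lbrakk>f \<in> hom C X Y; g \<in> hom C X A; k \<in> hom C Y X; f \<bottom> g\<rbrakk>
       \<Longrightarrow> (k \<cdot> f) \<bottom> (k \<cdot> g) \<and> (f \<cdot> k) \<bottom> g \<and>
           (k \<cdot> f) \<circledast> (k \<cdot> g) = k \<cdot> ((f \<cdot> k) \<circledast> g)"
    and wand_diagonal:
      "\<lbrakk>f \<in> hom C X X; f' \<in> hom C X X; g \<in> hom C X A; f \<bottom> f'; (f \<squnion> f') \<bottom> g\<rbrakk>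
       \<Longrightarrow> f \<bottom> g \<and> (f \<circledast> f') \<bottom> (f \<circledast> g) \<and>
           (f \<squnion> f') \<circledast> g = (f \<circledast> f') \<circledast> (f \<circledast> g)"

locale perp_itegory = extensive_restriction_category C + kleene_wand C W
  for C (structure) and W

definition uniform_wand :: "('o, 'm, 'x) ecat_scheme \<Rightarrow> ('m \<Rightarrow> 'm \<Rightarrow> 'm) \<Rightarrow> bool" where
  "uniform_wand C W \<longleftrightarrow>
    (\<forall>X Y A f g f' g' h.
       f \<in> hom C X X \<and> g \<in> hom C X A \<and> f' \<in> hom C Y Y \<and> g' \<in> hom C Y A \<and> h \<in> hom C X Y \<and>
       f \<bottom> g \<and> f' \<bottom> g' \<and> h \<cdot> g' = g \<and> h \<cdot> f' = f \<cdot> h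
       \<longrightarrow> h \<cdot> W f' g' = W f g)"
  for C (structure)

section \<open>Parametrized iteration\<close>

text \<open>The associator \<open>A + (B + D) \<rightarrow> (A + B) + D\<close>.\<close>

definition assoc_map :: "('o, 'm, 'x) ecat_scheme \<Rightarrow> 'o \<Rightarrow> 'o \<Rightarrow> 'o \<Rightarrow> 'm" where
  "assoc_map C A B D =
    (let T = \<Oplus> [\<Oplus> [A, B], D]; l = inj\<^sub>c [\<Oplus> [A, B], D] 0; r = inj\<^sub>c [\<Oplus> [A, B], D] 1
     in cotuple C T [inj\<^sub>c [A, B] 0 \<cdot> l, cotuple C T [inj\<^sub>c [A, B] 1 \<cdot> l, r]])"
  for C (structure)

text \<open>\<open>Iter X A f : X \<rightarrow> A\<close> for \<open>f : X \<rightarrow> X + A\<close>. In the diagonal axiom \<open>X + X + A\<close> is read as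
  \<open>X + (X + A)\<close> and the associator is made explicit.\<close>

locale parametrized_iteration =
  fixes C (structure) and Iter :: "'o \<Rightarrow> 'o \<Rightarrow> 'm \<Rightarrow> 'm"
  assumes iter_hom:
      "\<lbrakk>A \<in> Ob C; f \<in> hom C X (\<Oplus> [X, A])\<rbrakk> \<Longrightarrow> Iter X A f \<in> hom C X A"
    and iter_unfold:
      "\<lbrakk>A \<in> Ob C; f \<in> hom C X (\<Oplus> [X, A])\<rbrakk>
       \<Longrightarrow> f \<cdot> cotuple C A [Iter X A f, \<one> A] = Iter X A f"
    and iter_natural:
      "\<lbrakk>f \<in> hom C X (\<Oplus> [X, A']); h \<in> hom C A' A\<rbrakk>
       \<Longrightarrow> Iter X A (f \<cdot> map_sum C [\<one> X, h]) = Iter X A' f \<cdot> h"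
    and iter_dinatural:
      "\<lbrakk>A \<in> Ob C; f \<in> hom C X' (\<Oplus> [X, A]); k \<in> hom C X X'\<rbrakk>
       \<Longrightarrow> Iter X A (k \<cdot> f) = k \<cdot> Iter X' A (f \<cdot> map_sum C [k, \<one> A])"
    and iter_diagonal:
      "\<lbrakk>A \<in> Ob C; f \<in> hom C X (\<Oplus> [X, \<Oplus> [X, A]])\<rbrakk>
       \<Longrightarrow> Iter X A (Iter X (\<Oplus> [X, A]) f) =
           Iter X A (f \<cdot> (assoc_map C X X A \<cdot> map_sum C [codiag C 2 X, \<one> A]))"

definition uniform_iteration ::
  "('o, 'm, 'x) ecat_scheme \<Rightarrow> ('o \<Rightarrow> 'o \<Rightarrow> 'm \<Rightarrow> 'm) \<Rightarrow> bool" where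
  "uniform_iteration C Iter \<longleftrightarrow>
    (\<forall>X Y A f f' h.
       A \<in> Ob C \<and> f \<in> hom C X (\<Oplus> [X, A]) \<and> f' \<in> hom C Y (\<Oplus> [Y, A]) \<and> h \<in> hom C X Y \<and>
       f \<cdot> map_sum C [h, \<one> A] = h \<cdot> f'
       \<longrightarrow> Iter X A f = h \<cdot> Iter Y A f')"
  for C (structure)

locale traced_extensive_restriction_category =
  extensive_restriction_category C + parametrized_iteration C Iter
  for C (structure) and Iter

text \<open>\<open>Tr\<^sup>X\<^bsub>A,B\<^esub>(f) : A \<rightarrow> B\<close> for \<open>f : X + A \<rightarrow> X + B\<close>.\<close>

definition induced_trace ::
  "('o, 'm, 'x) ecat_scheme \<Rightarrow> ('o \<Rightarrow> 'o \<Rightarrow> 'm \<Rightarrow> 'm) \<Rightarrow> 'o \<Rightarrow> 'o \<Rightarrow> 'o \<Rightarrow> 'm \<Rightarrow> 'm" where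
  "induced_trace C Iter X A B f =
    inj\<^sub>c [X, A] 1 \<cdot> f \<cdot> cotuple C B [Iter X B (inj\<^sub>c [X, A] 0 \<cdot> f), \<one> B]"
  for C (structure)

definition iter_wand ::
  "('o, 'm, 'x) ecat_scheme \<Rightarrow> ('o \<Rightarrow> 'o \<Rightarrow> 'm \<Rightarrow> 'm) \<Rightarrow> 'm \<Rightarrow> 'm \<Rightarrow> 'm" where
  "iter_wand C Iter f g = Iter (Dom C f) (Cod C g) (row C f g)"

end

theory Submission
  imports Defs
begin

text \<open>
  A decision \<open>e : A \<rightarrow> A + A\<close> for \<open>h : A \<rightarrow> B + D\<close> has components \<open>\<rho>(h \<iota>\<^sub>1\<degree>)\<close> and \<open>\<rho>(h \<iota>\<^sub>2\<degree>)\<close>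
  and satisfies \<open>h = e (h \<iota>\<^sub>1\<degree> + h \<iota>\<^sub>2\<degree>)\<close>. Decisions are determined by their components, hence
  so is every map into a binary coproduct: \<open>f \<bottom> g\<close> holds iff some \<open>h\<close> has components \<open>f\<close> and \<open>g\<close>,
  and then \<open>h = [f g]\<close>. Each wand axiom thereby reduces to exhibiting a map with prescribed
  components and applying the iteration axiom of the same name.
\<close>

text \<open>Keeps the index of the second injection as \<open>1\<close>, the form in which the
  rewrite rules for \<open>inr\<close> and \<open>prr\<close> are stated.\<close>

declare One_nat_def [simp del]

section \<open>Binary coproducts and quasi-projections\<close>

lemma hom_iff: "f \<in> hom C A B \<longleftrightarrow> f \<in> Mor C \<and> Dom C f = A \<and> Cod C f = B"
  by (auto simp: hom_def)

lemma replicate_two: "replicate 2 x = [x, x]"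
  by (simp add: numeral_2_eq_2)

section \<open>Typed composition as rewriting\<close>

context category
begin

lemma homD: "f \<in> hom C A B \<Longrightarrow> f \<in> Mor C \<and> Dom C f = A \<and> Cod C f = B \<and> A \<in> Ob C \<and> B \<in> Ob C"
  using dom_Ob cod_Ob by (auto simp: hom_def)

text \<open>Typing is split into \<open>Mor\<close>, \<open>Dom\<close> and \<open>Cod\<close>, so
  that side conditions are discharged by rewriting, without guessing intermediate objects.\<close>

lemma comp_arr [simp]:
  assumes "f \<in> Mor C" "g \<in> Mor C" "Cod C f = Dom C g"
  shows "f \<cdot> g \<in> Mor C" "Dom C (f \<cdot> g) = Dom C f" "Cod C (f \<cdot> g) = Cod C g"
  using comp_hom[of f "Dom C f" "Dom C g" g "Cod C g"] assms by (auto simp: hom_def)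

lemma comp_assoc_arr [simp]:
  assumes "f \<in> Mor C" "g \<in> Mor C" "h \<in> Mor C" "Cod C f = Dom C g" "Cod C g = Dom C h"
  shows "f \<cdot> g \<cdot> h = f \<cdot> (g \<cdot> h)"
  by (rule comp_assoc) (use assms in \<open>auto simp: hom_def\<close>)

lemma id_arr [simp]:
  assumes "A \<in> Ob C"
  shows "\<one> A \<in> Mor C" "Dom C (\<one> A) = A" "Cod C (\<one> A) = A"
  using id_hom[OF assms] by (auto simp: hom_def)

lemma id_comp [simp]: "f \<in> Mor C \<Longrightarrow> Dom C f = A \<Longrightarrow> \<one> A \<cdot> f = f"
  by (rule id_left) (auto simp: hom_def)

lemma comp_id [simp]: "f \<in> Mor C \<Longrightarrow> Cod C f = B \<Longrightarrow> f \<cdot> \<one> B = f"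
  by (rule id_right) (auto simp: hom_def)

end

section \<open>Restrictions of composites and the restriction order\<close>

context restriction_category
begin

lemma rst_arr [simp]:
  assumes "f \<in> Mor C"
  shows "\<rho> f \<in> Mor C" "Dom C (\<rho> f) = Dom C f" "Cod C (\<rho> f) = Dom C f"
  using rst_hom[of f "Dom C f" "Cod C f"] assms by (auto simp: hom_def)

lemma rst_comp_self [simp]: "f \<in> Mor C \<Longrightarrow> \<rho> f \<cdot> f = f"
  by (rule rst_comp) (auto simp: hom_def)

lemma rst_id [simp]:
  assumes "A \<in> Ob C"
  shows "\<rho> (\<one> A) = \<one> A"
proof -
  have "\<rho> (\<one> A) \<cdot> \<one> A = \<rho> (\<one> A)" using assms by (intro comp_id) auto
  then show ?thesis using assms by (metis id_arr(1) rst_comp_self)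
qed

lemma rst_rst [simp]:
  assumes "f \<in> Mor C"
  shows "\<rho> (\<rho> f) = \<rho> f"
  using rst_rst_comp[of "\<one> (Dom C f)" "Dom C f" "Dom C f" f "Cod C f"] assms dom_Ob
  by (simp add: hom_iff)

text \<open>Totality of \<open>g\<close> turns \<open>f \<cdot> \<rho> g\<close> into
  \<open>f\<close>, so \<open>comp_rst\<close> puts \<open>\<rho> f\<close> below
  \<open>\<rho> (f \<cdot> g)\<close>. The opposite inequality holds because
  \<open>f \<cdot> g\<close> absorbs \<open>\<rho> f\<close>.\<close>

lemma rst_comp_total:
  assumes f: "f \<in> hom C A B" and g: "g \<in> hom C B D" and tot: "\<rho> g = \<one> B"
  shows "\<rho> (f \<cdot> g) = \<rho> f"
proof -
  have fg: "f \<cdot> g \<in> hom C A D" using f g by (rule comp_hom)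
  have "f = \<rho> (f \<cdot> g) \<cdot> f" using comp_rst[OF f g] f tot by (simp add: hom_iff)
  then have "\<rho> f = \<rho> (f \<cdot> g) \<cdot> \<rho> f" using rst_rst_comp[OF f fg] by simp
  also have "\<dots> = \<rho> (\<rho> f \<cdot> (f \<cdot> g))"
    using rst_commute[OF f fg] rst_rst_comp[OF fg f] by simp
  also have "\<rho> f \<cdot> (f \<cdot> g) = f \<cdot> g"
    using f g comp_assoc_arr[of "\<rho> f" f g] by (simp add: hom_iff del: comp_assoc_arr)
  finally show ?thesis by simp
qed

text \<open>Restrictions commute: \<open>f = \<rho> f \<cdot> \<rho> g \<cdot> f = \<rho> g \<cdot>
  \<rho> f \<cdot> f = \<rho> g \<cdot> f = g\<close>.\<close>

lemma restriction_le_antisym: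
  assumes f: "f \<in> hom C A B" and g: "g \<in> hom C A B"
    and fg: "\<rho> f \<cdot> g = f" and gf: "\<rho> g \<cdot> f = g"
  shows "f = g"
proof -
  have "f = \<rho> f \<cdot> (\<rho> g \<cdot> f)" using fg gf by simp
  also have "\<dots> = (\<rho> g \<cdot> \<rho> f) \<cdot> f"
    using rst_commute[OF f g] f g
    by (metis comp_assoc rst_hom)
  also have "\<dots> = \<rho> g \<cdot> f"
    using f g by (simp add: hom_iff)
  finally show ?thesis using gf by simp
qed

end

section \<open>Binary copairings, sums and codiagonals\<close>

context cocartesian_restriction_category
begin

abbreviation inl where "inl A B \<equiv> inj\<^sub>c [A, B] 0"
abbreviation inr where "inr A B \<equiv> inj\<^sub>c [A, B] 1"

lemma coprod_in_Ob [simp]: "A \<in> Ob C \<Longrightarrow> B \<in> Ob C \<Longrightarrow> \<Oplus> [A, B] \<in> Ob C"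
  by (rule coprod_Ob) auto

lemma inj_arr [simp]:
  assumes "A \<in> Ob C" "B \<in> Ob C"
  shows "inl A B \<in> Mor C" "Dom C (inl A B) = A" "Cod C (inl A B) = \<Oplus> [A, B]"
    "inr A B \<in> Mor C" "Dom C (inr A B) = B" "Cod C (inr A B) = \<Oplus> [A, B]"
  using inj_hom[of "[A, B]" 0] inj_hom[of "[A, B]" 1] assms by (auto simp: hom_iff)

lemma rst_inj [simp]:
  assumes "A \<in> Ob C" "B \<in> Ob C"
  shows "\<rho> (inl A B) = \<one> A" "\<rho> (inr A B) = \<one> B"
  using inj_total[of "[A, B]" 0] inj_total[of "[A, B]" 1] assms by (auto simp: total_map_def)

lemma binary_coprod_universal:
  assumes "f \<in> hom C A D" "g \<in> hom C B D"
  shows "\<exists>!h. h \<in> hom C (\<Oplus> [A, B]) D \<and> inl A B \<cdot> h = f \<and> inr A B \<cdot> h = g"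
proof -
  note * = assms[THEN homD]
  have "[f, g] ! i \<in> hom C ([A, B] ! i) D" if "i < length [A, B]" for i
    using that assms by (auto simp: less_Suc_eq)
  from coprod_universal[OF _ _ _ this] * show ?thesis
    by (simp add: All_less_Suc One_nat_def conj_commute)
qed

lemma coprod_ext:
  assumes "h \<in> Mor C" "h' \<in> Mor C" "Dom C h = \<Oplus> [A, B]" "Dom C h' = \<Oplus> [A, B]"
    "Cod C h = Cod C h'" "A \<in> Ob C" "B \<in> Ob C"
    "inl A B \<cdot> h = inl A B \<cdot> h'" "inr A B \<cdot> h = inr A B \<cdot> h'"
  shows "h = h'"
proof -
  have "inl A B \<cdot> h \<in> hom C A (Cod C h)" "inr A B \<cdot> h \<in> hom C B (Cod C h)"
    using assms(1-7) by (auto simp: hom_iff)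
  from binary_coprod_universal[OF this] show ?thesis
    using assms by (auto simp: hom_iff)
qed

lemma cotuple_two:
  assumes "f \<in> Mor C" "g \<in> Mor C" "Cod C f = D" "Cod C g = D"
  shows "cotuple C D [f, g] \<in> hom C (\<Oplus> [Dom C f, Dom C g]) D \<and>
    inl (Dom C f) (Dom C g) \<cdot> cotuple C D [f, g] = f \<and>
    inr (Dom C f) (Dom C g) \<cdot> cotuple C D [f, g] = g"
proof -
  have "f \<in> hom C (Dom C f) D" "g \<in> hom C (Dom C g) D" using assms by (auto simp: hom_iff)
  from theI'[OF binary_coprod_universal[OF this]] show ?thesis
    by (simp add: cotuple_def All_less_Suc One_nat_def conj_commute)
qed

lemma cotuple_arr [simp]:
  assumes "f \<in> Mor C" "g \<in> Mor C" "Cod C f = D" "Cod C g = D"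
  shows "cotuple C D [f, g] \<in> Mor C" "Dom C (cotuple C D [f, g]) = \<Oplus> [Dom C f, Dom C g]"
    "Cod C (cotuple C D [f, g]) = D"
  using cotuple_two[OF assms] by (auto simp: hom_iff)

lemma inj_cotuple [simp]:
  assumes "f \<in> Mor C" "g \<in> Mor C" "Cod C f = D" "Cod C g = D" "Dom C f = A" "Dom C g = B"
  shows "inl A B \<cdot> cotuple C D [f, g] = f" "inr A B \<cdot> cotuple C D [f, g] = g"
  using cotuple_two[OF assms(1-4)] assms(5,6) by auto

text \<open>Composites are normalised to the right, so each cancellation law also needs a version in
  which a further map follows.\<close>

lemma inj_cotuple_comp [simp]:
  assumes "f \<in> Mor C" "g \<in> Mor C" "Cod C f = D" "Cod C g = D" "Dom C f = A" "Dom C g = B"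
    "h \<in> Mor C" "Dom C h = D"
  shows "inl A B \<cdot> (cotuple C D [f, g] \<cdot> h) = f \<cdot> h" "inr A B \<cdot> (cotuple C D [f, g] \<cdot> h) = g \<cdot> h"
proof -
  have "A \<in> Ob C" "B \<in> Ob C" using assms dom_Ob by auto
  then show "inl A B \<cdot> (cotuple C D [f, g] \<cdot> h) = f \<cdot> h"
    "inr A B \<cdot> (cotuple C D [f, g] \<cdot> h) = g \<cdot> h"
    using assms comp_assoc_arr[of "inl A B" "cotuple C D [f, g]" h]
      comp_assoc_arr[of "inr A B" "cotuple C D [f, g]" h]
    by (simp_all del: comp_assoc_arr)
qed

lemma map_sum_two:
  "map_sum C [f, g] = cotuple C (\<Oplus> [Cod C f, Cod C g])
    [f \<cdot> inl (Cod C f) (Cod C g), g \<cdot> inr (Cod C f) (Cod C g)]"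
  by (simp add: map_sum_def One_nat_def)

lemma map_sum_arr [simp]:
  assumes "f \<in> Mor C" "g \<in> Mor C"
  shows "map_sum C [f, g] \<in> Mor C" "Dom C (map_sum C [f, g]) = \<Oplus> [Dom C f, Dom C g]"
    "Cod C (map_sum C [f, g]) = \<Oplus> [Cod C f, Cod C g]"
  using assms cod_Ob by (simp_all add: map_sum_two)

lemma inj_map_sum [simp]:
  assumes "f \<in> Mor C" "g \<in> Mor C" "Dom C f = A" "Dom C g = B"
  shows "inl A B \<cdot> map_sum C [f, g] = f \<cdot> inl (Cod C f) (Cod C g)"
    "inr A B \<cdot> map_sum C [f, g] = g \<cdot> inr (Cod C f) (Cod C g)"
  using assms cod_Ob by (simp_all add: map_sum_two)

lemma inj_map_sum_comp [simp]:
  assumes "f \<in> Mor C" "g \<in> Mor C" "Dom C f = A" "Dom C g = B"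
    "h \<in> Mor C" "Dom C h = \<Oplus> [Cod C f, Cod C g]"
  shows "inl A B \<cdot> (map_sum C [f, g] \<cdot> h) = f \<cdot> (inl (Cod C f) (Cod C g) \<cdot> h)"
    "inr A B \<cdot> (map_sum C [f, g] \<cdot> h) = g \<cdot> (inr (Cod C f) (Cod C g) \<cdot> h)"
  using assms cod_Ob by (simp_all add: map_sum_two)

lemma codiag_two: "codiag C 2 A = cotuple C A [\<one> A, \<one> A]"
  by (simp add: codiag_def replicate_two)

lemma codiag_arr [simp]:
  assumes "A \<in> Ob C"
  shows "codiag C 2 A \<in> Mor C" "Dom C (codiag C 2 A) = \<Oplus> [A, A]" "Cod C (codiag C 2 A) = A"
    "inl A A \<cdot> codiag C 2 A = \<one> A" "inr A A \<cdot> codiag C 2 A = \<one> A"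
  using assms by (simp_all add: codiag_two)

lemma inj_codiag_comp [simp]:
  assumes "h \<in> Mor C" "Dom C h = A"
  shows "inl A A \<cdot> (codiag C 2 A \<cdot> h) = h" "inr A A \<cdot> (codiag C 2 A \<cdot> h) = h"
  using assms dom_Ob by (auto simp: codiag_two)

lemma map_sum_comp [simp]:
  assumes "f \<in> Mor C" "g \<in> Mor C" "f' \<in> Mor C" "g' \<in> Mor C" "Cod C f = Dom C f'" "Cod C g = Dom C g'"
  shows "map_sum C [f, g] \<cdot> map_sum C [f', g'] = map_sum C [f \<cdot> f', g \<cdot> g']"
  by (rule coprod_ext[of _ _ "Dom C f" "Dom C g"]) (use assms dom_Ob cod_Ob in simp_all)

lemma map_sum_comp_comp [simp]:
  assumes "f \<in> Mor C" "g \<in> Mor C" "f' \<in> Mor C" "g' \<in> Mor C" "Cod C f = Dom C f'" "Cod C g = Dom C g'"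
    "h \<in> Mor C" "Dom C h = \<Oplus> [Cod C f', Cod C g']"
  shows "map_sum C [f, g] \<cdot> (map_sum C [f', g'] \<cdot> h) = map_sum C [f \<cdot> f', g \<cdot> g'] \<cdot> h"
  by (rule coprod_ext[of _ _ "Dom C f" "Dom C g"]) (use assms dom_Ob cod_Ob in simp_all)

lemma map_sum_id:
  assumes "A \<in> Ob C" "B \<in> Ob C"
  shows "map_sum C [\<one> A, \<one> B] = \<one> (\<Oplus> [A, B])"
  by (rule coprod_ext[of _ _ A B]) (use assms in simp_all)

lemma map_sum_inj_codiag:
  assumes "A \<in> Ob C" "B \<in> Ob C"
  shows "map_sum C [inl A B, inr A B] \<cdot> codiag C 2 (\<Oplus> [A, B]) = \<one> (\<Oplus> [A, B])"
  by (rule coprod_ext[of _ _ A B]) (use assms in simp_all)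

lemma map_sum_codiag:
  assumes "f \<in> Mor C" "Cod C f = B"
  shows "map_sum C [f, f] \<cdot> codiag C 2 B = codiag C 2 (Dom C f) \<cdot> f"
  by (rule coprod_ext[of _ _ "Dom C f" "Dom C f"]) (use assms dom_Ob cod_Ob in auto)

text \<open>By \<open>comp_rst\<close>, an injection can be moved past the restriction. Each
  injection followed by the codiagonal is an identity, so the restriction is the identity on both
  summands.\<close>

lemma rst_codiag:
  assumes A: "A \<in> Ob C"
  shows "\<rho> (codiag C 2 A) = \<one> (\<Oplus> [A, A])"
proof (rule coprod_ext[of _ _ A A])
  have l: "inl A A \<in> hom C A (\<Oplus> [A, A])" and r: "inr A A \<in> hom C A (\<Oplus> [A, A])"
    and n: "codiag C 2 A \<in> hom C (\<Oplus> [A, A]) A"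
    using A by (auto simp: hom_iff)
  show "inl A A \<cdot> \<rho> (codiag C 2 A) = inl A A \<cdot> \<one> (\<Oplus> [A, A])"
    using comp_rst[OF l n] A by simp
  show "inr A A \<cdot> \<rho> (codiag C 2 A) = inr A A \<cdot> \<one> (\<Oplus> [A, A])"
    using comp_rst[OF r n] A by simp
qed (use A in simp_all)

lemma rst_map_sum:
  assumes f: "f \<in> hom C A B" and g: "g \<in> hom C A' B'"
  shows "\<rho> (map_sum C [f, g]) = map_sum C [\<rho> f, \<rho> g]"
proof (rule coprod_ext[of _ _ A A'])
  note * = homD[OF f] homD[OF g]
  have l: "inl A A' \<in> hom C A (\<Oplus> [A, A'])" and r: "inr A A' \<in> hom C A' (\<Oplus> [A, A'])"
    and n: "map_sum C [f, g] \<in> hom C (\<Oplus> [A, A']) (\<Oplus> [B, B'])"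
    and l': "inl B B' \<in> hom C B (\<Oplus> [B, B'])" and r': "inr B B' \<in> hom C B' (\<Oplus> [B, B'])"
    using * by (auto simp: hom_iff)
  show "inl A A' \<cdot> \<rho> (map_sum C [f, g]) = inl A A' \<cdot> map_sum C [\<rho> f, \<rho> g]"
    using comp_rst[OF l n] * rst_comp_total[OF f l'] by simp
  show "inr A A' \<cdot> \<rho> (map_sum C [f, g]) = inr A A' \<cdot> map_sum C [\<rho> f, \<rho> g]"
    using comp_rst[OF r n] * rst_comp_total[OF g r'] by simp
qed (use homD[OF f] homD[OF g] in simp_all)

end

section \<open>Zero maps and quasi-projections\<close>

context extensive_restriction_category
begin

abbreviation prl where "prl A B \<equiv> quasi_proj C [A, B] 0"
abbreviation prr where "prr A B \<equiv> quasi_proj C [A, B] 1"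

lemma zero_arr [simp]:
  assumes "A \<in> Ob C" "B \<in> Ob C"
  shows "\<zero> A B \<in> Mor C" "Dom C (\<zero> A B) = A" "Cod C (\<zero> A B) = B"
  using zero_hom[OF assms] by (auto simp: hom_iff)

lemma zero_comp_arr [simp]:
  "f \<in> Mor C \<Longrightarrow> Dom C f = B \<Longrightarrow> A \<in> Ob C \<Longrightarrow> \<zero> A B \<cdot> f = \<zero> A (Cod C f)"
  by (rule zero_comp) (auto simp: hom_iff)

lemma comp_zero_arr [simp]:
  "f \<in> Mor C \<Longrightarrow> Cod C f = B \<Longrightarrow> D \<in> Ob C \<Longrightarrow> f \<cdot> \<zero> B D = \<zero> (Dom C f) D"
  by (rule comp_zero) (auto simp: hom_iff)

text \<open>Replaces the definite description by a copairing, on which the rewrite rules for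
  injections compute.\<close>

lemma quasi_proj_two:
  assumes A: "A \<in> Ob C" and B: "B \<in> Ob C"
  shows "prl A B = cotuple C A [\<one> A, \<zero> B A]" "prr A B = cotuple C B [\<zero> A B, \<one> B]"
proof -
  let ?l = "cotuple C A [\<one> A, \<zero> B A]" and ?r = "cotuple C B [\<zero> A B, \<one> B]"
  have l: "q = ?l" if "q \<in> hom C (\<Oplus> [A, B]) A" "inl A B \<cdot> q = \<one> A" "inr A B \<cdot> q = \<zero> B A" for q
    by (rule coprod_ext[of _ _ A B]) (use A B that in \<open>simp_all add: hom_iff\<close>)
  have r: "q = ?r" if "q \<in> hom C (\<Oplus> [A, B]) B" "inl A B \<cdot> q = \<zero> A B" "inr A B \<cdot> q = \<one> B" for q
    by (rule coprod_ext[of _ _ A B]) (use A B that in \<open>simp_all add: hom_iff\<close>)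
  have l': "?l \<in> hom C (\<Oplus> [A, B]) A" "inl A B \<cdot> ?l = \<one> A" "inr A B \<cdot> ?l = \<zero> B A"
    and r': "?r \<in> hom C (\<Oplus> [A, B]) B" "inl A B \<cdot> ?r = \<zero> A B" "inr A B \<cdot> ?r = \<one> B"
    using A B by (simp_all add: hom_iff)
  show "prl A B = ?l" unfolding quasi_proj_def
    by (rule the_equality) (use l' in \<open>auto simp: All_less_Suc One_nat_def intro!: l\<close>)
  show "prr A B = ?r" unfolding quasi_proj_def
    by (rule the_equality) (use r' in \<open>auto simp: All_less_Suc One_nat_def intro!: r\<close>)
qed

lemma quasi_proj_arr [simp]:
  assumes "A \<in> Ob C" "B \<in> Ob C"
  shows "prl A B \<in> Mor C" "Dom C (prl A B) = \<Oplus> [A, B]" "Cod C (prl A B) = A"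
    "prr A B \<in> Mor C" "Dom C (prr A B) = \<Oplus> [A, B]" "Cod C (prr A B) = B"
  using assms by (simp_all add: quasi_proj_two)

lemma inj_quasi_proj [simp]:
  assumes "A \<in> Ob C" "B \<in> Ob C"
  shows "inl A B \<cdot> prl A B = \<one> A" "inr A B \<cdot> prl A B = \<zero> B A"
    "inl A B \<cdot> prr A B = \<zero> A B" "inr A B \<cdot> prr A B = \<one> B"
  using assms by (simp_all add: quasi_proj_two)

lemma inj_quasi_proj_comp [simp]:
  assumes "A \<in> Ob C" "B \<in> Ob C" "h \<in> Mor C"
  shows "Dom C h = A \<Longrightarrow> inl A B \<cdot> (prl A B \<cdot> h) = h"
    "Dom C h = A \<Longrightarrow> inr A B \<cdot> (prl A B \<cdot> h) = \<zero> B (Cod C h)"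
    "Dom C h = B \<Longrightarrow> inl A B \<cdot> (prr A B \<cdot> h) = \<zero> A (Cod C h)"
    "Dom C h = B \<Longrightarrow> inr A B \<cdot> (prr A B \<cdot> h) = h"
  using assms by (simp_all add: quasi_proj_two)

lemma map_sum_quasi_proj [simp]:
  assumes "f \<in> Mor C" "g \<in> Mor C" "Cod C f = A" "Cod C g = B"
  shows "map_sum C [f, g] \<cdot> prl A B = prl (Dom C f) (Dom C g) \<cdot> f"
    "map_sum C [f, g] \<cdot> prr A B = prr (Dom C f) (Dom C g) \<cdot> g"
proof -
  have *: "A \<in> Ob C" "B \<in> Ob C" "Dom C f \<in> Ob C" "Dom C g \<in> Ob C"
    using assms dom_Ob cod_Ob by auto
  show "map_sum C [f, g] \<cdot> prl A B = prl (Dom C f) (Dom C g) \<cdot> f"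
    by (rule coprod_ext[of _ _ "Dom C f" "Dom C g"]) (use assms * in simp_all)
  show "map_sum C [f, g] \<cdot> prr A B = prr (Dom C f) (Dom C g) \<cdot> g"
    by (rule coprod_ext[of _ _ "Dom C f" "Dom C g"]) (use assms * in simp_all)
qed

text \<open>Both sides act as the injection on the matching summand and as zero on the other one;
  \<open>comp_rst\<close> computes the left side there.\<close>

lemma rst_quasi_proj:
  assumes A: "A \<in> Ob C" and B: "B \<in> Ob C"
  shows "\<rho> (prl A B) = prl A B \<cdot> inl A B" "\<rho> (prr A B) = prr A B \<cdot> inr A B"
proof -
  have l: "inl A B \<in> hom C A (\<Oplus> [A, B])" and r: "inr A B \<in> hom C B (\<Oplus> [A, B])"
    and p: "prl A B \<in> hom C (\<Oplus> [A, B]) A" and q: "prr A B \<in> hom C (\<Oplus> [A, B]) B"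
    using A B by (auto simp: hom_iff)
  show "\<rho> (prl A B) = prl A B \<cdot> inl A B"
    by (rule coprod_ext[of _ _ A B])
      (use A B comp_rst[OF l p] comp_rst[OF r p] in \<open>simp_all add: rst_zero\<close>)
  show "\<rho> (prr A B) = prr A B \<cdot> inr A B"
    by (rule coprod_ext[of _ _ A B])
      (use A B comp_rst[OF l q] comp_rst[OF r q] in \<open>simp_all add: rst_zero\<close>)
qed

section \<open>Decisions\<close>

lemma decides_two:
  assumes "f \<in> hom C A (\<Oplus> [B, D])"
  shows "decides C [B, D] f e \<longleftrightarrow> e \<in> hom C A (\<Oplus> [A, A]) \<and> \<rho> f = e \<cdot> codiag C 2 A \<and>
    e \<cdot> map_sum C [f, f] = f \<cdot> map_sum C [inl B D, inr B D]"
  using assms by (simp add: decides_def hom_iff numeral_2_eq_2 One_nat_def)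

text \<open>Since \<open>\<rho> q\<close> followed by the codiagonal is \<open>q\<close>, moving
  \<open>e\<close> past \<open>\<rho> q\<close> gives
  \<open>e \<cdot> q = \<rho> (e \<cdot> q) \<cdot> \<rho> f\<close>. A product of restriction
  idempotents is its own restriction.\<close>

lemma component_restriction_idempotent:
  assumes e: "e \<in> hom C A (\<Oplus> [A, A])" and f: "f \<in> hom C A B" and ef: "e \<cdot> codiag C 2 A = \<rho> f"
    and q: "q = prl A A \<or> q = prr A A"
  shows "e \<cdot> q = \<rho> (e \<cdot> q)" "e \<cdot> q = e \<cdot> q \<cdot> \<rho> f"
proof -
  note * = homD[OF e] homD[OF f]
  have q_hom: "q \<in> hom C (\<Oplus> [A, A]) A" using q * by (auto simp: hom_iff)
  have q_le: "\<rho> q \<cdot> codiag C 2 A = q" using q * by (auto simp: rst_quasi_proj)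
  have eq: "e \<cdot> q \<in> hom C A A" using comp_hom[OF e q_hom] .
  have "e \<cdot> q = (e \<cdot> \<rho> q) \<cdot> codiag C 2 A"
    using * homD[OF q_hom] q_le by simp
  also have "\<dots> = \<rho> (e \<cdot> q) \<cdot> (e \<cdot> codiag C 2 A)"
    using * homD[OF q_hom] comp_rst[OF e q_hom]
    by (simp del: comp_assoc_arr add: comp_assoc_arr[of "\<rho> (e \<cdot> q)" e "codiag C 2 A"])
  also have "\<dots> = \<rho> (e \<cdot> q) \<cdot> \<rho> f" using ef by simp
  finally have 1: "e \<cdot> q = \<rho> (e \<cdot> q) \<cdot> \<rho> f" .
  have "\<rho> (e \<cdot> q) = \<rho> (\<rho> (e \<cdot> q) \<cdot> \<rho> f)" using 1 by simp
  also have "\<dots> = \<rho> (e \<cdot> q) \<cdot> \<rho> f"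
    using rst_rst_comp[OF rst_hom[OF f] eq] * by simp
  finally show 2: "e \<cdot> q = \<rho> (e \<cdot> q)" using 1 by simp
  show "e \<cdot> q = e \<cdot> q \<cdot> \<rho> f" using 1 2 by simp
qed

text \<open>All five equations come from following the second decision equation by suitable maps;
  the first two then arise by taking restrictions of the last two.\<close>

lemma decides_components:
  assumes f: "f \<in> hom C A (\<Oplus> [B, D])" and B: "B \<in> Ob C" and D: "D \<in> Ob C"
    and dec: "decides C [B, D] f e"
  shows "e \<cdot> prl A A = \<rho> (f \<cdot> prl B D)" "e \<cdot> prr A A = \<rho> (f \<cdot> prr B D)"
    "e \<cdot> map_sum C [f \<cdot> prl B D, f \<cdot> prr B D] = f"
    "e \<cdot> prl A A \<cdot> f = f \<cdot> prl B D \<cdot> inl B D" "e \<cdot> prr A A \<cdot> f = f \<cdot> prr B D \<cdot> inr B D"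
proof -
  from dec have e: "e \<in> hom C A (\<Oplus> [A, A])" and ef: "e \<cdot> codiag C 2 A = \<rho> f"
    and sum: "e \<cdot> map_sum C [f, f] = f \<cdot> map_sum C [inl B D, inr B D]"
    using decides_two[OF f] by auto
  note * = homD[OF e] homD[OF f] B D
  have post: "e \<cdot> (map_sum C [f, f] \<cdot> k) = f \<cdot> (map_sum C [inl B D, inr B D] \<cdot> k)"
    if "k \<in> Mor C" "Dom C k = \<Oplus> [\<Oplus> [B, D], \<Oplus> [B, D]]" for k
    using arg_cong[OF sum, of "\<lambda>x. x \<cdot> k"] * that by simp
  show l: "e \<cdot> prl A A \<cdot> f = f \<cdot> prl B D \<cdot> inl B D"
    using post[of "prl (\<Oplus> [B, D]) (\<Oplus> [B, D])"] * by simp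
  show r: "e \<cdot> prr A A \<cdot> f = f \<cdot> prr B D \<cdot> inr B D"
    using post[of "prr (\<Oplus> [B, D]) (\<Oplus> [B, D])"] * by simp
  \<comment> \<open>Following by the sum of the quasi-projections cancels the injections on the
    right-hand side.\<close>
  show "e \<cdot> map_sum C [f \<cdot> prl B D, f \<cdot> prr B D] = f"
    using post[of "map_sum C [prl B D, prr B D]"] * by (simp add: map_sum_id)
  \<comment> \<open>Handles both components at once: the left side of \<open>eq\<close> has
    restriction \<open>e \<cdot> q\<close>, and on the right side the total map \<open>i\<close>
    does not affect the restriction.\<close>
  have key: "e \<cdot> q = \<rho> (f \<cdot> p)"
    if q: "q = prl A A \<or> q = prr A A" and p: "p \<in> hom C (\<Oplus> [B, D]) P"
      and i: "i \<in> hom C P (\<Oplus> [B, D])" "\<rho> i = \<one> P" and eq: "e \<cdot> q \<cdot> f = f \<cdot> p \<cdot> i" for q p i P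
  proof -
    note idem = component_restriction_idempotent[OF e f ef q]
    have eq_hom: "e \<cdot> q \<in> hom C A A" using q * by (auto simp: hom_iff)
    have "\<rho> (\<rho> (e \<cdot> q) \<cdot> f) = \<rho> (e \<cdot> q) \<cdot> \<rho> f" by (rule rst_rst_comp[OF f eq_hom])
    then have "\<rho> (e \<cdot> q \<cdot> f) = e \<cdot> q" using idem by simp
    moreover have "\<rho> (f \<cdot> p \<cdot> i) = \<rho> (f \<cdot> p)"
      using rst_comp_total[OF comp_hom[OF f p] i] .
    ultimately show ?thesis using eq by simp
  qed
  show "e \<cdot> prl A A = \<rho> (f \<cdot> prl B D)"
    by (rule key[OF _ _ _ _ l]) (use * in \<open>auto simp: hom_iff\<close>)
  show "e \<cdot> prr A A = \<rho> (f \<cdot> prr B D)"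
    by (rule key[OF _ _ _ _ r]) (use * in \<open>auto simp: hom_iff\<close>)
qed

text \<open>A decision \<open>d\<close> for \<open>e\<close> refines it: \<open>e\<close> is
  \<open>d\<close> followed by a sum of restriction idempotents, hence
  \<open>e = \<rho> e \<cdot> d\<close>. The codiagonal is total, so \<open>d\<close> and
  \<open>e\<close> have the same restriction and must coincide.\<close>

lemma decides_self:
  assumes f: "f \<in> hom C A (\<Oplus> [B, D])" and B: "B \<in> Ob C" and D: "D \<in> Ob C"
    and dec: "decides C [B, D] f e"
  shows "decides C [A, A] e e"
proof -
  from dec have e: "e \<in> hom C A (\<Oplus> [A, A])" and ef: "e \<cdot> codiag C 2 A = \<rho> f"
    using decides_two[OF f] by auto
  note * = homD[OF e] homD[OF f] B D
  obtain d where d: "decides C [A, A] e d"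
    using decision_exists[of "[A, A]" e A] e * by auto
  then have d_hom: "d \<in> hom C A (\<Oplus> [A, A])" and de: "d \<cdot> codiag C 2 A = \<rho> e"
    using decides_two[OF e] by auto
  note ** = * homD[OF d_hom]
  define k where "k = map_sum C [e \<cdot> prl A A, e \<cdot> prr A A]"
  have A: "A \<in> Ob C" using * by simp
  have dk: "d \<cdot> k = e" unfolding k_def by (rule decides_components(3)[OF e A A d])
  have k_hom: "k \<in> hom C (\<Oplus> [A, A]) (\<Oplus> [A, A])" unfolding k_def using * by (simp add: hom_iff)
  have "\<rho> k = k"
    using rst_map_sum[of "e \<cdot> prl A A" A A "e \<cdot> prr A A" A A] *
      component_restriction_idempotent(1)[OF e f ef]
    by (simp add: k_def hom_iff)
  then have "d \<cdot> k = \<rho> (d \<cdot> k) \<cdot> d" using comp_rst[OF d_hom k_hom] by simp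
  then have "e = \<rho> e \<cdot> d" by (simp add: dk)
  moreover have "\<rho> d = \<rho> e"
    using rst_comp_total[OF d_hom _ rst_codiag[OF A], of A] de ** by (simp add: hom_iff)
  ultimately have "e = d" using ** by (metis rst_comp_self)
  with d show ?thesis by simp
qed

text \<open>On the part selected by its left component \<open>e'\<close> acts as \<open>inl\<close>,
  and on the part selected by its right component as \<open>inr\<close>. Since \<open>e\<close> has
  the same components, it can trade the injections for \<open>e'\<close>.\<close>

lemma decision_le:
  assumes e: "e \<in> hom C A (\<Oplus> [A, A])" and e': "e' \<in> hom C A (\<Oplus> [A, A])"
    and dec: "decides C [A, A] e e" and dec': "decides C [A, A] e' e'"
    and l: "e \<cdot> prl A A = e' \<cdot> prl A A" and r: "e \<cdot> prr A A = e' \<cdot> prr A A"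
  shows "\<rho> e \<cdot> e' = e"
proof -
  note * = homD[OF e] homD[OF e']
  have A: "A \<in> Ob C" using * by simp
  define a where "a = e \<cdot> prl A A"
  define b where "b = e \<cdot> prr A A"
  have ab: "a \<in> Mor C" "b \<in> Mor C" "Dom C a = A" "Dom C b = A" "Cod C a = A" "Cod C b = A"
    using * by (simp_all add: a_def b_def)
  have ee: "e \<cdot> map_sum C [a, b] = e"
    unfolding a_def b_def by (rule decides_components(3)[OF e A A dec])
  have ae: "a \<cdot> e' = a \<cdot> inl A A"
    using decides_components(4)[OF e' A A dec'] l by (simp add: a_def)
  have be: "b \<cdot> e' = b \<cdot> inr A A"
    using decides_components(5)[OF e' A A dec'] r by (simp add: b_def)
  \<comment> \<open>The sum of the components may be inserted or removed right after
    \<open>e\<close>. It is inserted below just long enough for \<open>ae\<close> and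
    \<open>be\<close> to apply.\<close>
  have absorb: "e \<cdot> k = e \<cdot> (map_sum C [a, b] \<cdot> k)" if "k \<in> Mor C" "Dom C k = \<Oplus> [A, A]" for k
    using arg_cong[OF ee, of "\<lambda>x. x \<cdot> k"] * ab that by simp
  have "e = e \<cdot> (map_sum C [inl A A, inr A A] \<cdot> codiag C 2 (\<Oplus> [A, A]))"
    using * by (simp add: map_sum_inj_codiag)
  also have "\<dots> = e \<cdot> (map_sum C [a, b] \<cdot> (map_sum C [inl A A, inr A A] \<cdot> codiag C 2 (\<Oplus> [A, A])))"
    using * by (intro absorb) simp_all
  also have "\<dots> = e \<cdot> (map_sum C [a, b] \<cdot> (map_sum C [e', e'] \<cdot> codiag C 2 (\<Oplus> [A, A])))"
    using * ab by (simp add: ae be)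
  also have "\<dots> = e \<cdot> (map_sum C [e', e'] \<cdot> codiag C 2 (\<Oplus> [A, A]))"
    using * by (intro absorb[symmetric]) simp_all
  also have "\<dots> = (e \<cdot> codiag C 2 A) \<cdot> e'"
    using * by (simp add: map_sum_codiag)
  also have "\<dots> = \<rho> e \<cdot> e'"
    using dec decides_two[OF e] by simp
  finally show ?thesis by simp
qed

lemma decision_unique:
  assumes "e \<in> hom C A (\<Oplus> [A, A])" "e' \<in> hom C A (\<Oplus> [A, A])"
    "decides C [A, A] e e" "decides C [A, A] e' e'"
    "e \<cdot> prl A A = e' \<cdot> prl A A" "e \<cdot> prr A A = e' \<cdot> prr A A"
  shows "e = e'"
  using restriction_le_antisym[OF assms(1,2) decision_le[OF assms]
      decision_le[OF assms(2,1,4,3) assms(5,6)[symmetric]]] .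

text \<open>Any two candidates are decisions by \<open>decides_self\<close> and have the same
  components, which depend on \<open>f\<close> alone. This makes the \<open>THE\<close> in
  \<open>decision_of\<close> well defined.\<close>

lemma decides_unique:
  assumes f: "f \<in> hom C A (\<Oplus> [B, D])" and B: "B \<in> Ob C" and D: "D \<in> Ob C"
    and dec: "decides C [B, D] f e" and dec': "decides C [B, D] f e'"
  shows "e = e'"
proof (rule decision_unique)
  show "e \<in> hom C A (\<Oplus> [A, A])" "e' \<in> hom C A (\<Oplus> [A, A])"
    using dec dec' decides_two[OF f] by auto
  show "decides C [A, A] e e" "decides C [A, A] e' e'"
    using decides_self[OF f B D] dec dec' by auto
qed (use decides_components(1,2)[OF f B D dec] decides_components(1,2)[OF f B D dec'] in simp_all)

lemma is_decision_iff:
  assumes A: "A \<in> Ob C"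
  shows "is_decision C 2 A d \<longleftrightarrow> d \<in> hom C A (\<Oplus> [A, A]) \<and> decides C [A, A] d d"
proof (cases "d \<in> hom C A (\<Oplus> [A, A])")
  case True
  obtain e where e: "decides C [A, A] d e"
    using decision_exists[of "[A, A]" d A] A True by auto
  have "decision_of C [A, A] d = e"
    unfolding decision_of_def using e decides_unique[OF True A A] by blast
  then show ?thesis
    using True e decides_unique[OF True A A] by (auto simp: is_decision_def replicate_two)
qed (simp add: is_decision_def replicate_two)

section \<open>Disjointness and matrices\<close>

text \<open>A map is rebuilt from its decision and its two components, and the decision is itself
  fixed by the restrictions of those components.\<close>

lemma quasi_proj_jointly_monic:
  assumes h: "h \<in> hom C A (\<Oplus> [B, D])" and h': "h' \<in> hom C A (\<Oplus> [B, D])"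
    and B: "B \<in> Ob C" and D: "D \<in> Ob C"
    and l: "h \<cdot> prl B D = h' \<cdot> prl B D" and r: "h \<cdot> prr B D = h' \<cdot> prr B D"
  shows "h = h'"
proof -
  obtain e e' where e: "decides C [B, D] h e" and e': "decides C [B, D] h' e'"
    using decision_exists[of "[B, D]"] B D h h' by (metis bot.extremum empty_set insert_subset list.simps(15))
  have "e = e'"
  proof (rule decision_unique)
    show "e \<in> hom C A (\<Oplus> [A, A])" "e' \<in> hom C A (\<Oplus> [A, A])"
      using e e' decides_two[OF h] decides_two[OF h'] by auto
    show "decides C [A, A] e e" "decides C [A, A] e' e'"
      using decides_self[OF h B D e] decides_self[OF h' B D e'] by auto
  qed (use decides_components(1,2)[OF h B D e] decides_components(1,2)[OF h' B D e'] l r in simp_all)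
  then have "e \<cdot> map_sum C [h \<cdot> prl B D, h \<cdot> prr B D] = e' \<cdot> map_sum C [h' \<cdot> prl B D, h' \<cdot> prr B D]"
    by (simp only: l r)
  then show ?thesis
    unfolding decides_components(3)[OF h B D e] decides_components(3)[OF h' B D e'] .
qed

lemma separates_iff:
  assumes "f \<in> hom C A B"
  shows "separates C f g d \<longleftrightarrow> d \<in> hom C A (\<Oplus> [A, A]) \<and> decides C [A, A] d d \<and>
    d \<cdot> prl A A = \<rho> f \<and> d \<cdot> prr A A = \<rho> g"
  using homD[OF assms] by (simp add: separates_def is_decision_iff)

text \<open>\<open>decision_unique\<close> makes the \<open>THE\<close> in \<open>separator\<close>
  well defined. A quasi-projection turns the row into \<open>\<rho> f\<close> followed by
  \<open>f\<close>, or \<open>\<rho> g\<close> followed by \<open>g\<close>, and the restriction is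
  absorbed.\<close>

lemma row_components:
  assumes f: "f \<in> hom C A B" and g: "g \<in> hom C A D" and fg: "f \<bottom> g"
  shows "row C f g \<in> hom C A (\<Oplus> [B, D])" "row C f g \<cdot> prl B D = f" "row C f g \<cdot> prr B D = g"
proof -
  note * = homD[OF f] homD[OF g]
  obtain d where d: "separates C f g d" using fg by (auto simp: dperp_def)
  then have d': "d \<in> hom C A (\<Oplus> [A, A])" "d \<cdot> prl A A = \<rho> f" "d \<cdot> prr A A = \<rho> g"
    using separates_iff[OF f] by auto
  have "separator C f g = d"
    unfolding separator_def
  proof (rule the_equality)
    show "separates C f g d" by (rule d)
  next
    fix d2 assume "separates C f g d2"
    with d show "d2 = d" using separates_iff[OF f] decision_unique[of d2 A d] by simp
  qed
  then have row: "row C f g = d \<cdot> map_sum C [f, g]" by (simp add: row_def)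
  note ** = * homD[OF d'(1)]
  show "row C f g \<in> hom C A (\<Oplus> [B, D])" using ** by (simp add: row hom_iff)
  have "d \<cdot> prl A A \<cdot> f = f" "d \<cdot> prr A A \<cdot> g = g" using d'(2,3) ** by (simp_all del: comp_assoc_arr)
  then show "row C f g \<cdot> prl B D = f" "row C f g \<cdot> prr B D = g"
    using ** by (simp_all add: row)
qed

text \<open>The decision for \<open>h\<close> has components \<open>\<rho> f\<close> and
  \<open>\<rho> g\<close>, so it separates them. Joint monicity then identifies \<open>h\<close>
  with the row.\<close>

lemma perp_row_components:
  assumes h: "h \<in> hom C A (\<Oplus> [B, D])" and B: "B \<in> Ob C" and D: "D \<in> Ob C"
    and f: "h \<cdot> prl B D = f" and g: "h \<cdot> prr B D = g"
  shows "f \<bottom> g" "row C f g = h"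
proof -
  note * = homD[OF h] B D
  have f_hom: "f \<in> hom C A B" and g_hom: "g \<in> hom C A D"
    using * f g by (auto simp: hom_iff)
  obtain e where e: "decides C [B, D] h e"
    using decision_exists[of "[B, D]" h A] B D h by auto
  have "separates C f g e"
    using e decides_two[OF h] decides_components(1,2)[OF h B D e] decides_self[OF h B D e] f g
    by (simp add: separates_iff[OF f_hom])
  then show perp: "f \<bottom> g"
    using f_hom g_hom by (auto simp: dperp_def hom_iff)
  show "row C f g = h"
    using row_components[OF f_hom g_hom perp] f g
    by (intro quasi_proj_jointly_monic[OF _ h B D]) simp_all
qed

lemma join_row: "f \<in> hom C A B \<Longrightarrow> f \<squnion> g = row C f g \<cdot> codiag C 2 B"
  by (simp add: join_def row_def hom_iff)

text \<open>Quasi-projections are natural in the summands, so the right-hand side has the required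
  components. Taking \<open>h\<close> or \<open>k\<close> to be an identity changes a single
  column.\<close>

lemma row_comp_map_sum:
  assumes f: "f \<in> hom C A B" and g: "g \<in> hom C A D" and fg: "f \<bottom> g"
    and h: "h \<in> hom C B B'" and k: "k \<in> hom C D D'"
  shows "(f \<cdot> h) \<bottom> (g \<cdot> k)" "row C (f \<cdot> h) (g \<cdot> k) = row C f g \<cdot> map_sum C [h, k]"
proof -
  note row = row_components[OF f g fg]
  note * = homD[OF f] homD[OF g] homD[OF h] homD[OF k] homD[OF row(1)]
  have m: "row C f g \<cdot> map_sum C [h, k] \<in> hom C A (\<Oplus> [B', D'])"
    using * by (simp add: hom_iff)
  have "row C f g \<cdot> prl B D \<cdot> h = f \<cdot> h" "row C f g \<cdot> prr B D \<cdot> k = g \<cdot> k"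
    using row(2,3) by simp_all
  then have "row C f g \<cdot> map_sum C [h, k] \<cdot> prl B' D' = f \<cdot> h"
    "row C f g \<cdot> map_sum C [h, k] \<cdot> prr B' D' = g \<cdot> k"
    using * by simp_all
  from perp_row_components[OF m _ _ this] *
  show "(f \<cdot> h) \<bottom> (g \<cdot> k)" "row C (f \<cdot> h) (g \<cdot> k) = row C f g \<cdot> map_sum C [h, k]"
    by auto
qed

lemma comp_row:
  assumes f: "f \<in> hom C A B" and g: "g \<in> hom C A D" and fg: "f \<bottom> g" and k: "k \<in> hom C Z A"
  shows "(k \<cdot> f) \<bottom> (k \<cdot> g)" "row C (k \<cdot> f) (k \<cdot> g) = k \<cdot> row C f g"
proof -
  note row = row_components[OF f g fg]
  note * = homD[OF f] homD[OF g] homD[OF k] homD[OF row(1)]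
  have "k \<cdot> row C f g \<in> hom C Z (\<Oplus> [B, D])" using * by (simp add: hom_iff)
  from perp_row_components[OF this, of "k \<cdot> f" "k \<cdot> g"] * row
  show "(k \<cdot> f) \<bottom> (k \<cdot> g)" "row C (k \<cdot> f) (k \<cdot> g) = k \<cdot> row C f g"
    by simp_all
qed

text \<open>A separator sees its maps only through their restrictions, so even the codomain may
  change.\<close>

lemma perp_cong_rst:
  assumes f: "f \<in> hom C A B" and g: "g \<in> hom C A D" and fg: "f \<bottom> g"
    and f': "f' \<in> hom C A B'" and "\<rho> f' = \<rho> f"
  shows "f' \<bottom> g"
  using assms by (auto simp: dperp_def separates_def hom_iff)

end

section \<open>The wand of an iteration operator\<close>

context traced_extensive_restriction_category
begin

lemma iter_wand_eq: "f \<in> hom C X X \<Longrightarrow> g \<in> hom C X A \<Longrightarrow> iter_wand C Iter f g = Iter X A (row C f g)"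
  by (simp add: iter_wand_def hom_iff)

lemma iter_wand_hom:
  assumes f: "f \<in> hom C X X" and g: "g \<in> hom C X A" and fg: "f \<bottom> g"
  shows "iter_wand C Iter f g \<in> hom C X A"
  using iter_hom[OF _ row_components(1)[OF f g fg]] homD[OF g] by (simp add: iter_wand_eq[OF f g])

text \<open>Both injections cancel against the codiagonal, so the trace is one unfolding of the
  iterate.\<close>

lemma iter_row_eq_trace:
  assumes f: "f \<in> hom C X X" and g: "g \<in> hom C X A" and fg: "f \<bottom> g"
  shows "Iter X A (row C f g) = induced_trace C Iter X X A (codiag C 2 X \<cdot> row C f g)"
proof -
  have r: "row C f g \<in> hom C X (\<Oplus> [X, A])" by (rule row_components[OF f g fg])
  have A: "A \<in> Ob C" using homD[OF g] by simp
  show ?thesis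
    using iter_unfold[OF A r] homD[OF r] homD[OF g] homD[OF iter_hom[OF A r]]
    by (simp add: induced_trace_def)
qed

text \<open>The unfolding equation is the codiagonal of a matrix with columns \<open>g\<close> and
  \<open>f \<cdot> w\<close>.\<close>

lemma iter_wand_unfold:
  assumes f: "f \<in> hom C X X" and g: "g \<in> hom C X A" and fg: "f \<bottom> g"
  defines "w \<equiv> iter_wand C Iter f g"
  shows "g \<bottom> (f \<cdot> w)" "g \<squnion> (f \<cdot> w) = w"
proof -
  note row = row_components[OF f g fg]
  have A: "A \<in> Ob C" using homD[OF g] by simp
  have w: "w \<in> hom C X A" unfolding w_def by (rule iter_wand_hom[OF f g fg])
  have unfold: "row C f g \<cdot> cotuple C A [w, \<one> A] = w"
    using iter_unfold[OF A row(1)] by (simp add: w_def iter_wand_eq[OF f g])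
  note * = homD[OF f] homD[OF g] homD[OF w] homD[OF row(1)]
  \<comment> \<open>The axiom lists \<open>g\<close> first, so the exit goes to the left copy of
    \<open>A\<close>, and the loop state is sent through \<open>w\<close> to the right copy.\<close>
  define h where "h = row C f g \<cdot> cotuple C (\<Oplus> [A, A]) [w \<cdot> inr A A, inl A A]"
  have h: "h \<in> hom C X (\<Oplus> [A, A])" using * by (simp add: h_def hom_iff)
  have 1: "cotuple C (\<Oplus> [A, A]) [w \<cdot> inr A A, inl A A] \<cdot> prl A A = prr X A"
    by (rule coprod_ext[of _ _ X A]) (use * in simp_all)
  have 2: "cotuple C (\<Oplus> [A, A]) [w \<cdot> inr A A, inl A A] \<cdot> prr A A = prl X A \<cdot> w"
    by (rule coprod_ext[of _ _ X A]) (use * in simp_all)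
  have 3: "cotuple C (\<Oplus> [A, A]) [w \<cdot> inr A A, inl A A] \<cdot> codiag C 2 A = cotuple C A [w, \<one> A]"
    by (rule coprod_ext[of _ _ X A]) (use * in simp_all)
  have "row C f g \<cdot> prl X A \<cdot> w = f \<cdot> w" using row(2) by simp
  then have hr: "h \<cdot> prr A A = f \<cdot> w" using * by (simp add: h_def 2)
  have hl: "h \<cdot> prl A A = g" using * row(3) by (simp add: h_def 1)
  note perp = perp_row_components[OF h A A hl hr]
  show "g \<bottom> (f \<cdot> w)" by (rule perp(1))
  have "h \<cdot> codiag C 2 A = w" using * unfold by (simp add: h_def 3)
  then show "g \<squnion> (f \<cdot> w) = w" by (simp add: join_row[OF g] perp(2))
qed

lemma iter_wand_natural:
  assumes f: "f \<in> hom C X X" and g: "g \<in> hom C X A" and h: "h \<in> hom C A B" and fg: "f \<bottom> g"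
  shows "f \<bottom> (g \<cdot> h)" "iter_wand C Iter f g \<cdot> h = iter_wand C Iter f (g \<cdot> h)"
proof -
  note * = homD[OF f] homD[OF g] homD[OF h]
  have "\<one> X \<in> hom C X X" using * by (simp add: hom_iff)
  from row_comp_map_sum[OF f g fg this h] *
  have r: "f \<bottom> (g \<cdot> h)" "row C f (g \<cdot> h) = row C f g \<cdot> map_sum C [\<one> X, h]"
    by simp_all
  show "f \<bottom> (g \<cdot> h)" by (rule r)
  show "iter_wand C Iter f g \<cdot> h = iter_wand C Iter f (g \<cdot> h)"
    using iter_natural[OF row_components(1)[OF f g fg] h] f g comp_hom[OF g h]
    by (simp add: iter_wand_eq r)
qed

text \<open>Precomposing the row with \<open>k\<close> gives the matrix on the left; following it by
  \<open>k\<close> on the first summand gives the one on the right. These are the two maps iterated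
  in \<open>iter_dinatural\<close>.\<close>

lemma iter_wand_dinatural:
  assumes f: "f \<in> hom C X Y" and g: "g \<in> hom C X A" and k: "k \<in> hom C Y X" and fg: "f \<bottom> g"
  shows "(k \<cdot> f) \<bottom> (k \<cdot> g)" "(f \<cdot> k) \<bottom> g"
    "iter_wand C Iter (k \<cdot> f) (k \<cdot> g) = k \<cdot> iter_wand C Iter (f \<cdot> k) g"
proof -
  note * = homD[OF f] homD[OF g] homD[OF k]
  have "\<one> A \<in> hom C A A" using * by (simp add: hom_iff)
  from row_comp_map_sum[OF f g fg k this] *
  have r: "(f \<cdot> k) \<bottom> g" "row C (f \<cdot> k) g = row C f g \<cdot> map_sum C [k, \<one> A]"
    by simp_all
  note s = comp_row[OF f g fg k]
  show "(k \<cdot> f) \<bottom> (k \<cdot> g)" by (rule s)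
  show "(f \<cdot> k) \<bottom> g" by (rule r)
  show "iter_wand C Iter (k \<cdot> f) (k \<cdot> g) = k \<cdot> iter_wand C Iter (f \<cdot> k) g"
    using iter_dinatural[OF _ row_components(1)[OF f g fg] k] *
      iter_wand_eq[OF comp_hom[OF k f] comp_hom[OF k g]] iter_wand_eq[OF comp_hom[OF f k] g]
    by (simp add: r s)
qed

text \<open>The inner iteration loops on \<open>f\<close> and exits through \<open>f'\<close> or
  \<open>g\<close>; the outer one loops on the exit through \<open>f'\<close>.
  \<open>iter_diagonal\<close> equates this with a single loop on the merged first two
  columns.\<close>

lemma iter_wand_diagonal:
  assumes f: "f \<in> hom C X X" and f': "f' \<in> hom C X X" and g: "g \<in> hom C X A"
    and ff': "f \<bottom> f'" and fg: "(f \<squnion> f') \<bottom> g"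
  shows "f \<bottom> g" "iter_wand C Iter f f' \<bottom> iter_wand C Iter f g"
    "iter_wand C Iter (f \<squnion> f') g = iter_wand C Iter (iter_wand C Iter f f') (iter_wand C Iter f g)"
proof -
  have X: "X \<in> Ob C" and A: "A \<in> Ob C" using homD[OF f] homD[OF g] by simp_all
  note s = row_components[OF f f' ff']
  have join: "f \<squnion> f' = row C f f' \<cdot> codiag C 2 X" by (rule join_row[OF f])
  have n: "codiag C 2 X \<in> hom C (\<Oplus> [X, X]) X" using X by (simp add: hom_iff)
  have join_hom: "f \<squnion> f' \<in> hom C X X" unfolding join by (rule comp_hom[OF s(1) n])
  \<comment> \<open>Disjointness from \<open>g\<close> is known for the join but needed for the
    unmerged row; totality of the codiagonal transfers it.\<close>
  have "\<rho> (row C f f') = \<rho> (f \<squnion> f')"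
    unfolding join by (rule rst_comp_total[OF s(1) n rst_codiag[OF X], symmetric])
  then have sg: "row C f f' \<bottom> g" by (rule perp_cong_rst[OF join_hom g fg s(1)])
  define t where "t = row C (row C f f') g"
  note t = row_components[OF s(1) g sg, folded t_def]
  note * = homD[OF f] homD[OF f'] homD[OF g] homD[OF s(1)] homD[OF t(1)]
  have idA: "\<one> A \<in> hom C A A" using A by (simp add: hom_iff)
  have row_join: "row C (f \<squnion> f') g = t \<cdot> map_sum C [codiag C 2 X, \<one> A]"
    using row_comp_map_sum(2)[OF s(1) g sg n idA] * by (simp add: join t_def)
  let ?XA = "\<Oplus> [X, A]" and ?XXA = "\<Oplus> [X, \<Oplus> [X, A]]"
  \<comment> \<open>Rebrackets \<open>(X + X) + A\<close> as \<open>X + (X + A)\<close>, against the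
    direction of \<open>assoc_map\<close>.\<close>
  define b where "b = cotuple C ?XXA [map_sum C [\<one> X, inl X A], inr X A \<cdot> inr X ?XA]"
  have b: "b \<in> Mor C" "Dom C b = \<Oplus> [\<Oplus> [X, X], A]" "Cod C b = ?XXA"
    using X A by (simp_all add: b_def)
  \<comment> \<open>The three-column matrix with entries \<open>f\<close>, \<open>f'\<close>, \<open>g\<close>: its iterate has columns
    \<open>f \<circledast> f'\<close> and \<open>f \<circledast> g\<close>, by naturality along the two quasi-projections.\<close>
  define h where "h = t \<cdot> b"
  have h: "h \<in> hom C X ?XXA" using b * by (simp add: h_def hom_iff)
  have assoc: "assoc_map C X X A \<in> Mor C" "Dom C (assoc_map C X X A) = ?XXA"
     "Cod C (assoc_map C X X A) = \<Oplus> [\<Oplus> [X, X], A]"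
    using X A by (simp_all add: assoc_map_def Let_def)
  have b_assoc: "b \<cdot> assoc_map C X X A = \<one> (\<Oplus> [\<Oplus> [X, X], A])"
  proof (rule coprod_ext[of _ _ "\<Oplus> [X, X]" A])
    show "inl (\<Oplus> [X, X]) A \<cdot> (b \<cdot> assoc_map C X X A) =
        inl (\<Oplus> [X, X]) A \<cdot> \<one> (\<Oplus> [\<Oplus> [X, X], A])"
      by (rule coprod_ext[of _ _ X X]) (use X A in \<open>simp_all add: b_def assoc_map_def Let_def\<close>)
  qed (use X A in \<open>simp_all add: b_def assoc_map_def Let_def\<close>)
  have h_assoc: "h \<cdot> (assoc_map C X X A \<cdot> map_sum C [codiag C 2 X, \<one> A]) = row C (f \<squnion> f') g"
  proof -
    have "b \<cdot> (assoc_map C X X A \<cdot> map_sum C [codiag C 2 X, \<one> A])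
        = (b \<cdot> assoc_map C X X A) \<cdot> map_sum C [codiag C 2 X, \<one> A]"
      using b assoc X A by simp
    then show ?thesis
      using b assoc * by (simp add: h_def row_join b_assoc)
  qed
  \<comment> \<open>Discards the third column, leaving the matrix of \<open>f\<close> and
    \<open>f'\<close>.\<close>
  have bl: "b \<cdot> map_sum C [\<one> X, prl X A] = prl (\<Oplus> [X, X]) A"
  proof (rule coprod_ext[of _ _ "\<Oplus> [X, X]" A])
    show "inl (\<Oplus> [X, X]) A \<cdot> (b \<cdot> map_sum C [\<one> X, prl X A]) =
        inl (\<Oplus> [X, X]) A \<cdot> prl (\<Oplus> [X, X]) A"
      using X A by (simp add: b_def map_sum_id)
  qed (use X A b in \<open>simp_all add: b_def\<close>)
  have hl: "h \<cdot> map_sum C [\<one> X, prl X A] = row C f f'"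
    using t(2) * b by (simp add: h_def bl)
  \<comment> \<open>Discards the middle column, leaving the matrix of \<open>f\<close> and
    \<open>g\<close>. Its components \<open>ml\<close> and \<open>mr\<close> also prove
    \<open>f \<bottom> g\<close>.\<close>
  have br: "b \<cdot> map_sum C [\<one> X, prr X A] =
      cotuple C ?XA [prl X X \<cdot> inl X A, inr X A]"
  proof (rule coprod_ext[of _ _ "\<Oplus> [X, X]" A])
    show "inl (\<Oplus> [X, X]) A \<cdot> (b \<cdot> map_sum C [\<one> X, prr X A]) =
        inl (\<Oplus> [X, X]) A \<cdot> cotuple C ?XA [prl X X \<cdot> inl X A, inr X A]"
      by (rule coprod_ext[of _ _ X X]) (use X A in \<open>simp_all add: b_def\<close>)
  qed (use X A b in \<open>simp_all add: b_def\<close>)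
  have pl: "cotuple C ?XA [prl X X \<cdot> inl X A, inr X A] \<cdot> prl X A = prl (\<Oplus> [X, X]) A \<cdot> prl X X"
    and pr: "cotuple C ?XA [prl X X \<cdot> inl X A, inr X A] \<cdot> prr X A = prr (\<Oplus> [X, X]) A"
    by (rule coprod_ext[of _ _ "\<Oplus> [X, X]" A]; use X A in simp)+
  have m: "h \<cdot> map_sum C [\<one> X, prr X A] \<in> hom C X ?XA"
    using homD[OF h] X A by (simp add: hom_iff)
  have "t \<cdot> prl (\<Oplus> [X, X]) A \<cdot> prl X X = f" using t(2) s(2) by simp
  then have ml: "h \<cdot> map_sum C [\<one> X, prr X A] \<cdot> prl X A = f"
    and mr: "h \<cdot> map_sum C [\<one> X, prr X A] \<cdot> prr X A = g"
    using t(3) * b comp_assoc_arr[of b "map_sum C [\<one> X, prr X A]" "prl X A"]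
      comp_assoc_arr[of b "map_sum C [\<one> X, prr X A]" "prr X A"]
    by (simp_all add: h_def br pl pr del: map_sum_quasi_proj)
  note fg' = perp_row_components[OF m X A ml mr]
  show "f \<bottom> g" by (rule fg')
  have pl_hom: "prl X A \<in> hom C ?XA X" and pr_hom: "prr X A \<in> hom C ?XA A"
    using X A by (simp_all add: hom_iff)
  have XA: "?XA \<in> Ob C" using X A by simp
  have il: "Iter X ?XA h \<cdot> prl X A = iter_wand C Iter f f'"
    using iter_natural[OF h pl_hom] by (simp add: iter_wand_eq[OF f f'] hl)
  have ir: "Iter X ?XA h \<cdot> prr X A = iter_wand C Iter f g"
    using iter_natural[OF h pr_hom] by (simp add: iter_wand_eq[OF f g] fg')
  have I: "Iter X ?XA h \<in> hom C X ?XA" by (rule iter_hom[OF XA h])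
  note W = perp_row_components[OF I X A il ir]
  show "iter_wand C Iter f f' \<bottom> iter_wand C Iter f g" by (rule W)
  show "iter_wand C Iter (f \<squnion> f') g = iter_wand C Iter (iter_wand C Iter f f') (iter_wand C Iter f g)"
    using iter_diagonal[OF A h] W(2) iter_wand_eq[OF join_hom g]
      iter_wand_eq[OF iter_wand_hom[OF f f' ff'] iter_wand_hom[OF f g fg'(1)]]
    by (simp add: h_assoc)
qed

lemma kleene_wand_iter_wand: "kleene_wand C (iter_wand C Iter)"
proof (rule kleene_wand.intro, goal_cases)
  case (1 f X g A)
  then show ?case by (rule iter_wand_hom)
next
  case (2 f X g A)
  show ?case using iter_wand_unfold[OF 2] by simp
next
  case (3 f X g A h B)
  show ?case using iter_wand_natural[OF 3] by simp
next
  case (4 f X Y g A k)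
  show ?case using iter_wand_dinatural[OF 4] by simp
next
  case (5 f X f' g A)
  show ?case using iter_wand_diagonal[OF 5] by simp
qed

text \<open>The two equations on \<open>h\<close> are the two columns of one matrix equation, which
  is the premise of \<open>uniform_iteration\<close>.\<close>

lemma uniform_iter_wand:
  assumes "uniform_iteration C Iter"
  shows "uniform_wand C (iter_wand C Iter)"
  unfolding uniform_wand_def
proof (intro allI impI, elim conjE)
  fix X Y A f g f' g' h
  assume f: "f \<in> hom C X X" and g: "g \<in> hom C X A" and f': "f' \<in> hom C Y Y"
    and g': "g' \<in> hom C Y A" and h: "h \<in> hom C X Y" and fg: "f \<bottom> g" and fg': "f' \<bottom> g'"
    and hg: "h \<cdot> g' = g" and hf: "h \<cdot> f' = f \<cdot> h"
  have A: "A \<in> Ob C" using homD[OF g] by simp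
  then have "\<one> A \<in> hom C A A" by (simp add: hom_iff)
  from row_comp_map_sum(2)[OF f g fg h this] comp_row(2)[OF f' g' fg' h]
  have "row C f g \<cdot> map_sum C [h, \<one> A] = h \<cdot> row C f' g'"
    using homD[OF g] by (simp add: hg hf)
  then have "Iter X A (row C f g) = h \<cdot> Iter Y A (row C f' g')"
    using assms A h row_components(1)[OF f g fg] row_components(1)[OF f' g' fg']
    unfolding uniform_iteration_def by blast
  then show "h \<cdot> iter_wand C Iter f' g' = iter_wand C Iter f g"
    by (simp add: iter_wand_eq[OF f g] iter_wand_eq[OF f' g'])
qed

end

theorem proposition9p10:
  fixes C :: "('o, 'm, 'x) ecat_scheme" (structure)
    and Iter :: "'o \<Rightarrow> 'o \<Rightarrow> 'm \<Rightarrow> 'm"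
  assumes "traced_extensive_restriction_category C Iter"
  shows "(\<forall>X A f g. f \<in> hom C X X \<and> g \<in> hom C X A \<and> f \<bottom> g \<longrightarrow>
            iter_wand C Iter f g = Iter X A (row C f g) \<and>
            Iter X A (row C f g) = induced_trace C Iter X X A (codiag C 2 X \<cdot> row C f g)) \<and>
         kleene_wand C (iter_wand C Iter) \<and>
         perp_itegory C (iter_wand C Iter) \<and>
         (uniform_iteration C Iter \<longrightarrow> uniform_wand C (iter_wand C Iter))"
proof -
  interpret traced_extensive_restriction_category C Iter by fact
  have "perp_itegory C (iter_wand C Iter)"
    by (intro perp_itegory.intro kleene_wand_iter_wand extensive_restriction_category_axioms)
  then show ?thesis
    by (auto intro: iter_wand_eq iter_row_eq_trace kleene_wand_iter_wand uniform_iter_wand)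
qed

end
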